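(* Let $A(n) = an^{-b} \exp(cn^\beta)$ with constants $a,b,c,\beta>0$, and fix an integer $k \geq 2$. Let $\{\varepsilon_n\}$ be positive reals with $\varepsilon_n\to0$, $\varepsilon_n \gg \frac{\log A(n)}{\sqrt{A(n)}}$ and $\varepsilon_n \gg A(n)^{-1/k}$ as $n \to \infty$. Let $\mathcal{S}_n = \{x\in \mathbb{N} : A(n)(1 - \varepsilon_n) \leq x \leq A(n) (1 + \varepsilon_n) \}$ and let $\mathbf{f}_n$ be uniformly distributed on $\mathcal{S}_n$. Then for every $\varepsilon>0$, with probability 1, for all sufficiently large $d$, \[ \mathbf{M}_{\mathbf{f},k}(d) < (2^{1/\beta} + \varepsilon) \left(\frac{k}{c(k - 1)} \right)^{\frac{1}{\beta}} (\log d)^{\frac{1}{\beta}}. \]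
   Context: $u_n\gg v_n$ means $u_n \ge C v_n$ for some constant $C>0$ and all sufficiently large $n$. $\mathbf{f}_n$ uniform on $\mathcal{S}_n$ means $\mathbb{P}(\mathbf{f}_n=m)=1/|\mathcal{S}_n|$ for $m\in\mathcal{S}_n$ and $0$ otherwise. Define $\mathbf{\Delta}_{\mathbf{f},k}(n) := \min \{ | \mathbf{f}_n- m^k| : m \in \mathbb{Z} \}$ and $\mathbf{M}_{\mathbf{f}, k}(d) := \max \{ n \in \mathbb{N} : \mathbf{\Delta}_{\mathbf{f}, k}(n) \leq d \}$, with value $\infty$ if no maximum exists. *)

theory Defs
  imports "HOL-Probability.Probability"
begin

text \<open>
  Throughout, the natural numbers of the source are the positive integers
  (the expression \<open>n powr (- b)\<close> is only meaningful for \<open>n \<ge> 1\<close>), so the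
  restriction to positive values is made explicit wherever the type \<open>nat\<close> is used.
\<close>

definition seq_gg :: "(nat \<Rightarrow> real) \<Rightarrow> (nat \<Rightarrow> real) \<Rightarrow> bool" where
  "seq_gg u v \<longleftrightarrow> (\<exists>C>0. \<forall>\<^sub>F n in sequentially. u n \<ge> C * v n)"

definition growth :: "real \<Rightarrow> real \<Rightarrow> real \<Rightarrow> real \<Rightarrow> nat \<Rightarrow> real" where
  "growth a b c \<beta> n = a * real n powr (- b) * exp (c * real n powr \<beta>)"

definition window :: "(nat \<Rightarrow> real) \<Rightarrow> (nat \<Rightarrow> real) \<Rightarrow> nat \<Rightarrow> nat set" where
  "window A e n = {x. 1 \<le> x \<and> A n * (1 - e n) \<le> real x \<and> real x \<le> A n * (1 + e n)}"

definition uniform_rv :: "'w measure \<Rightarrow> ('w \<Rightarrow> nat) \<Rightarrow> nat set \<Rightarrow> bool" where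
  "uniform_rv P X S \<longleftrightarrow>
     (\<forall>m. measure P {\<omega> \<in> space P. X \<omega> = m} = (if m \<in> S then 1 / real (card S) else 0))"

definition power_dist :: "nat \<Rightarrow> nat \<Rightarrow> nat" where
  "power_dist k x = (LEAST t. \<exists>m::int. int t = \<bar>int x - m ^ k\<bar>)"

text \<open>The value is \<open>\<infinity>\<close> whenever there is no maximum, i.e. also for the empty set.\<close>

definition last_close :: "(nat \<Rightarrow> nat) \<Rightarrow> nat \<Rightarrow> real \<Rightarrow> ereal" where
  "last_close f k d =
     (let N = {n. 1 \<le> n \<and> real (power_dist k (f n)) \<le> d}
      in if finite N \<and> N \<noteq> {} then ereal (real (Max N)) else \<infinity>)"

end

theory Submission
  imports Defs "HOL-Real_Asymp.Real_Asymp"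
begin

text \<open>
  A \<open>k\<close>-th power near \<open>A\<close> is separated from the next one by at least a constant times
  \<open>A powr (1 - 1/k)\<close>, so a proportion \<open>O(D * A powr (1/k - 1))\<close> of the window
  lies within \<open>D\<close> of a \<open>k\<close>-th power, as soon as the window is longer than \<open>D\<close> and than this gap.
  For \<open>D = exp ((n / K) powr \<beta>)\<close>, where \<open>K\<close> is the constant of the theorem, these proportions
  are summable over \<open>n\<close>. By the first Borel--Cantelli lemma, which needs no independence,
  almost surely \<open>f n\<close> is eventually farther than \<open>D\<close> from all \<open>k\<close>-th powers; inverting
  \<open>d = D\<close> gives the bound on the last index.
\<close>

text \<open>Since \<open>x\<close> is nonnegative, replacing an integer \<open>m\<close> by its
  absolute value cannot increase its distance \<open>\<bar>x - m ^ k\<bar>\<close>. Hence only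
  natural roots have to be counted later.\<close>

lemma power_dist_attained:
  obtains m :: nat where "\<bar>real x - real m ^ k\<bar> \<le> real (power_dist k x)"
proof -
  have "\<exists>m::int. int (power_dist k x) = \<bar>int x - m ^ k\<bar>"
    unfolding power_dist_def
    by (rule LeastI_ex) (rule exI[of _ "nat \<bar>int x - 0 ^ k\<bar>"], auto)
  then obtain m :: int where m: "int (power_dist k x) = \<bar>int x - m ^ k\<bar>" by blast
  have "\<bar>\<bar>int x\<bar> - \<bar>m ^ k\<bar>\<bar> \<le> \<bar>int x - m ^ k\<bar>" by (rule abs_triangle_ineq3)
  hence "\<bar>int x - int (nat \<bar>m\<bar>) ^ k\<bar> \<le> int (power_dist k x)"
    using m by (simp add: power_abs)
  hence "real_of_int \<bar>int x - int (nat \<bar>m\<bar>) ^ k\<bar> \<le> real_of_int (int (power_dist k x))"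
    by (simp only: of_int_le_iff)
  hence "\<bar>real x - real (nat \<bar>m\<bar>) ^ k\<bar> \<le> real (power_dist k x)"
    by simp
  thus thesis by (rule that)
qed

lemma finite_nat_between: "finite {x::nat. u \<le> real x \<and> real x \<le> v}"
  by (rule finite_subset[of _ "{..nat \<lfloor>v\<rfloor>}"]) (auto simp: le_nat_floor)

lemma card_nat_between_le:
  assumes "u \<le> v"
  shows "real (card {x::nat. u \<le> real x \<and> real x \<le> v}) \<le> v - u + 1"
proof -
  have "int ` {x::nat. u \<le> real x \<and> real x \<le> v} \<subseteq> {\<lceil>u\<rceil>..\<lfloor>v\<rfloor>}"
    by (auto simp: le_floor_iff ceiling_le_iff)
  hence "card (int ` {x::nat. u \<le> real x \<and> real x \<le> v}) \<le> card {\<lceil>u\<rceil>..\<lfloor>v\<rfloor>}"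
    by (intro card_mono) auto
  hence "card {x::nat. u \<le> real x \<and> real x \<le> v} \<le> nat (\<lfloor>v\<rfloor> - \<lceil>u\<rceil> + 1)"
    by (simp add: card_image)
  hence "real (card {x::nat. u \<le> real x \<and> real x \<le> v}) \<le> real (nat (\<lfloor>v\<rfloor> - \<lceil>u\<rceil> + 1))"
    by (simp only: of_nat_le_iff)
  also have "\<dots> \<le> v - u + 1"
    using assms by linarith
  finally show ?thesis .
qed

lemma card_nat_between_ge:
  assumes "0 \<le> u" "u \<le> v"
  shows "v - u - 1 \<le> real (card {x::nat. u \<le> real x \<and> real x \<le> v})"
proof -
  have "{nat \<lceil>u\<rceil>..nat \<lfloor>v\<rfloor>} \<subseteq> {x::nat. u \<le> real x \<and> real x \<le> v}"
  proof
    fix x assume "x \<in> {nat \<lceil>u\<rceil>..nat \<lfloor>v\<rfloor>}"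
    hence "\<lceil>u\<rceil> \<le> int x" "int x \<le> \<lfloor>v\<rfloor>"
      using assms by (simp_all del: ceiling_le_iff, linarith+)
    thus "x \<in> {x::nat. u \<le> real x \<and> real x \<le> v}"
      by (auto simp: le_floor_iff ceiling_le_iff)
  qed
  hence "card {nat \<lceil>u\<rceil>..nat \<lfloor>v\<rfloor>} \<le> card {x::nat. u \<le> real x \<and> real x \<le> v}"
    by (intro card_mono finite_nat_between)
  hence "real (Suc (nat \<lfloor>v\<rfloor>) - nat \<lceil>u\<rceil>) \<le> real (card {x::nat. u \<le> real x \<and> real x \<le> v})"
    by simp
  moreover have "v - u - 1 \<le> real (Suc (nat \<lfloor>v\<rfloor>) - nat \<lceil>u\<rceil>)"
    using assms by linarith
  ultimately show ?thesis by linarith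
qed

text \<open>One replaces \<open>n ^ (k - 1)\<close> by the smaller \<open>m ^ (k - 1)\<close> in
  \<open>n * n ^ (k - 1)\<close>. The mean value theorem would give an extra factor
  \<open>k\<close>, but constants do not matter for summability.\<close>

lemma power_gap:
  fixes m n k :: nat
  assumes "m \<le> n" "k \<ge> 1"
  shows "(real n - real m) * real m ^ (k - 1) \<le> real n ^ k - real m ^ k"
proof -
  obtain j where k: "k = Suc j" using assms(2) by (cases k) auto
  have "real n * real m ^ j \<le> real n * real n ^ j"
    using assms(1) by (intro mult_left_mono power_mono) auto
  thus ?thesis by (simp add: k algebra_simps)
qed

text \<open>All roots lie between the smallest one \<open>p\<close> and the largest one
  \<open>q\<close>, so there are at most \<open>q - p + 1\<close>. By the gap estimate,
  \<open>(q - p) * G\<close> is at most \<open>q ^ k - p ^ k\<close>, which is at most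
  \<open>v - u\<close>.\<close>

lemma card_roots_between:
  fixes u v G :: real and k :: nat
  assumes "u \<le> v" "G > 0" "k \<ge> 1"
    and G: "\<And>m. u \<le> real m ^ k \<Longrightarrow> G \<le> real m ^ (k - 1)"
  shows "finite {m::nat. u \<le> real m ^ k \<and> real m ^ k \<le> v}"
    and "real (card {m::nat. u \<le> real m ^ k \<and> real m ^ k \<le> v}) \<le> (v - u) / G + 1"
proof -
  let ?M = "{m::nat. u \<le> real m ^ k \<and> real m ^ k \<le> v}"
  show fin: "finite ?M"
  proof (rule finite_subset[OF _ finite_nat_between[of 0 v]], safe)
    fix m :: nat assume "real m ^ k \<le> v"
    \<comment> \<open>Roots are dominated by their powers, so \<open>v\<close> bounds them as
      well.\<close>
    moreover have "m \<le> m ^ k" using \<open>k \<ge> 1\<close> by (cases "m = 0") (auto intro: self_le_power)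
    hence "real m \<le> real m ^ k" by (metis of_nat_le_iff of_nat_power)
    ultimately show "real m \<le> v" by linarith
  qed simp
  show "real (card ?M) \<le> (v - u) / G + 1"
  proof (cases "?M = {}")
    case True
    have "0 \<le> (v - u) / G" using assms by simp
    with True show ?thesis by (simp del: Collect_empty_eq)
  next
    case False
    define p q where "p = Min ?M" and "q = Max ?M"
    have p: "p \<in> ?M" and q: "q \<in> ?M" using Min_in[OF fin False] Max_in[OF fin False]
      by (auto simp: p_def q_def)
    have pq: "p \<le> q" using fin False p by (simp add: q_def)
    have "?M \<subseteq> {p..q}" using fin by (auto simp: p_def q_def)
    hence "card ?M \<le> card {p..q}" by (intro card_mono) auto
    hence "real (card ?M) \<le> real q - real p + 1" using pq by simp
    moreover have "(real q - real p) * G \<le> (real q - real p) * real p ^ (k - 1)"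
      using G[of p] p pq by (intro mult_left_mono) auto
    hence "(real q - real p) * G \<le> v - u" 
      using power_gap[OF pq \<open>k \<ge> 1\<close>] p q by auto
    hence "real q - real p \<le> (v - u) / G" using \<open>G > 0\<close> by (simp add: pos_le_divide_eq)
    ultimately show ?thesis by linarith
  qed
qed

text \<open>Union bound: the bad points are covered by intervals of radius \<open>D\<close> around
  the relevant powers, and their number is divided by the size of the window. The condition
  \<open>D \<le> A * e\<close> lets the window be enlarged by \<open>D\<close> at the cost of a
  constant; the condition with \<open>C\<close> says that the window is at least of the order of the
  gap between powers.\<close>

lemma near_power_proportion:
  fixes A e D C :: real and k :: nat
  defines "S \<equiv> {x::nat. 1 \<le> x \<and> A * (1 - e) \<le> real x \<and> real x \<le> A * (1 + e)}"
  assumes "A > 0" "0 < e" "e \<le> 1/4" "1 \<le> A * e" "1 \<le> D" "D \<le> A * e" "C > 0" "k \<ge> 1"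
    and C: "C * A powr (- 1 / real k) \<le> e"
  shows "finite S" "S \<noteq> {}"
    and "real (card {x\<in>S. real (power_dist k x) \<le> D}) / real (card S)
           \<le> 3 * (8 + 1 / C) * (D * A powr (1 / real k - 1))"
proof -
  have pos: "A * (1 - e) > 0" using assms by simp
  have S: "S = {x::nat. A * (1 - e) \<le> real x \<and> real x \<le> A * (1 + e)}"
  proof -
    have "1 \<le> x" if "A * (1 - e) \<le> real x" for x :: nat
      using that pos by (cases x) auto
    thus ?thesis by (auto simp: S_def)
  qed
  show fin: "finite S" unfolding S by (rule finite_nat_between)
  \<comment> \<open>The length \<open>2 * A * e\<close> loses at most 1, which is at most
    \<open>A * e\<close>.\<close>
  have "A * (1 + e) - A * (1 - e) - 1 \<le> real (card S)"
    unfolding S using pos \<open>A > 0\<close> \<open>0 < e\<close> by (intro card_nat_between_ge) auto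
  hence cS: "A * e \<le> real (card S)" using \<open>1 \<le> A * e\<close> by (simp add: algebra_simps)
  thus "S \<noteq> {}" using \<open>1 \<le> A * e\<close> by auto

  \<comment> \<open>These are the roots whose powers can lie within \<open>D\<close> of a point of
    the window. \<open>G\<close> bounds the gaps between such powers from below.\<close>
  define M where "M = {m::nat. A * (1 - e) - D \<le> real m ^ k \<and> real m ^ k \<le> A * (1 + e) + D}"
  define G where "G = A powr (1 - 1 / real k) / 2"
  have G0: "G > 0" using \<open>A > 0\<close> by (simp add: G_def)
  have "G \<le> real m ^ (k - 1)" if m: "A * (1 - e) - D \<le> real m ^ k" for m :: nat
  proof -
    have "A * e \<le> A * (1/4)" using assms by (intro mult_left_mono) auto
    \<comment> \<open>Here \<open>D \<le> A * e\<close> and \<open>e \<le> 1/4\<close> give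
      \<open>A * (1 - e) - D \<ge> A - 2 * A * e \<ge> A / 2\<close>. The factor 1/2 in
      \<open>G\<close> results, because the exponent \<open>1 - 1 / k\<close> is at most 1.\<close>
    hence le: "A / 2 \<le> real m ^ k" using m \<open>D \<le> A * e\<close> by (simp add: algebra_simps)
    have m0: "m > 0"
    proof (rule ccontr)
      assume "\<not> m > 0"
      with le \<open>A > 0\<close> \<open>k \<ge> 1\<close> show False by (simp add: power_0_left)
    qed
    have exp: "0 \<le> 1 - 1 / real k" "1 - 1 / real k \<le> 1" using \<open>k \<ge> 1\<close> by auto
    have "(1/2) powr 1 \<le> (1/2::real) powr (1 - 1 / real k)"
      using exp by (intro powr_mono') auto
    hence "G \<le> (1/2) powr (1 - 1 / real k) * A powr (1 - 1 / real k)"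
      using mult_right_mono[of "1/2" _ "A powr (1 - 1 / real k)"] unfolding G_def by simp
    also have "\<dots> = (A / 2) powr (1 - 1 / real k)"
      using \<open>A > 0\<close> by (simp add: powr_divide)
    also have "\<dots> \<le> (real m ^ k) powr (1 - 1 / real k)"
      using le \<open>A > 0\<close> exp by (intro powr_mono2) auto
    also have "\<dots> = real m powr (real k * (1 - 1 / real k))"
      using m0 by (simp add: powr_powr flip: powr_realpow)
    also have "real k * (1 - 1 / real k) = real (k - 1)"
      using \<open>k \<ge> 1\<close> by (simp add: field_simps)
    also have "real m powr \<dots> = real m ^ (k - 1)"
      using m0 by (simp add: powr_realpow)
    finally show ?thesis .
  qed
  moreover have "A * (1 - e) - D \<le> A * (1 + e) + D"
    using assms by (simp add: algebra_simps)
  ultimately have finM: "finite M"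
    and cM: "real (card M) \<le> (A * (1 + e) + D - (A * (1 - e) - D)) / G + 1"
    unfolding M_def using card_roots_between[of _ _ G k] G0 \<open>k \<ge> 1\<close> by blast+
  have "(A * (1 + e) + D - (A * (1 - e) - D)) / G \<le> (4 * (A * e)) / G"
    using \<open>D \<le> A * e\<close> G0 by (intro divide_right_mono) (auto simp: algebra_simps)
  also have "\<dots> = 8 * (e * A powr (1 / real k))"
    using \<open>A > 0\<close> by (simp add: G_def powr_diff)
  finally have "real (card M) \<le> 8 * (e * A powr (1 / real k)) + 1" using cM by linarith
  \<comment> \<open>The extra 1 in the count of roots is absorbed into the main term, at the cost of
    \<open>1 / C\<close> in the constant.\<close>
  moreover have "1 \<le> 1 / C * (e * A powr (1 / real k))"
    using C \<open>C > 0\<close> \<open>A > 0\<close> by (simp add: powr_minus field_simps)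
  ultimately have cM': "real (card M) \<le> (8 + 1 / C) * (e * A powr (1 / real k))"
    by (simp only: distrib_right)

  define B where "B = {x\<in>S. real (power_dist k x) \<le> D}"
  define I where "I m = {x::nat. real m ^ k - D \<le> real x \<and> real x \<le> real m ^ k + D}" for m
  have "B \<subseteq> (\<Union>m\<in>M. I m)"
  proof
    fix x assume x: "x \<in> B"
    obtain m where "\<bar>real x - real m ^ k\<bar> \<le> real (power_dist k x)"
      by (rule power_dist_attained)
    hence "\<bar>real x - real m ^ k\<bar> \<le> D" using x by (simp add: B_def)
    hence "x \<in> I m" "m \<in> M" using x by (auto simp: B_def S I_def M_def)
    thus "x \<in> (\<Union>m\<in>M. I m)" by blast
  qed
  moreover have finI: "finite (I m)" for m unfolding I_def by (rule finite_nat_between)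
  ultimately have "card B \<le> card (\<Union>m\<in>M. I m)" using finM by (intro card_mono) auto
  also have "\<dots> \<le> (\<Sum>m\<in>M. card (I m))" by (rule card_UN_le[OF finM])
  finally have "real (card B) \<le> (\<Sum>m\<in>M. real (card (I m)))"
    by (metis of_nat_le_iff of_nat_sum)
  also have "\<dots> \<le> (\<Sum>m\<in>M. 3 * D)"
  proof (rule sum_mono)
    fix m
    \<comment> \<open>An interval of length \<open>2 * D\<close> holds at most
      \<open>2 * D + 1\<close> integers, and \<open>1 \<le> D\<close>.\<close>
    show "real (card (I m)) \<le> 3 * D"
      using card_nat_between_le[of "real m ^ k - D" "real m ^ k + D"] \<open>1 \<le> D\<close>
      unfolding I_def by simp
  qed
  also have "\<dots> = real (card M) * (3 * D)" by simp
  also have "\<dots> \<le> (8 + 1 / C) * (e * A powr (1 / real k)) * (3 * D)"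
    using cM' \<open>1 \<le> D\<close> by (intro mult_right_mono) auto
  \<comment> \<open>The factor \<open>e\<close> in the number of roots cancels against the one in
    the size of the window, so the final bound is free of \<open>e\<close>.\<close>
  finally have "real (card B) / real (card S)
      \<le> (8 + 1 / C) * (e * A powr (1 / real k)) * (3 * D) / (A * e)"
    using cS assms by (intro frac_le) auto
  also have "\<dots> = 3 * (8 + 1 / C) * (D * A powr (1 / real k - 1))"
    using \<open>A > 0\<close> \<open>0 < e\<close> by (simp add: powr_diff)
  finally show "real (card {x\<in>S. real (power_dist k x) \<le> D}) / real (card S)
           \<le> 3 * (8 + 1 / C) * (D * A powr (1 / real k - 1))" by (simp only: B_def)
qed

lemma (in prob_space) prob_uniform_rv:
  assumes "uniform_rv M X S" "finite B" "B \<subseteq> S" "X \<in> measurable M (count_space UNIV)"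
  shows "prob {\<omega>\<in>space M. X \<omega> \<in> B} = real (card B) / real (card S)"
proof -
  have "{\<omega>\<in>space M. X \<omega> \<in> B} = (\<Union>m\<in>B. {\<omega>\<in>space M. X \<omega> = m})" by auto
  also have "prob \<dots> = (\<Sum>m\<in>B. prob {\<omega>\<in>space M. X \<omega> = m})"
    using assms(2,4) by (intro finite_measure_finite_Union) (auto simp: disjoint_family_on_def)
  also have "\<dots> = (\<Sum>m\<in>B. 1 / real (card S))"
    using assms(1,3) by (intro sum.cong) (auto simp: uniform_rv_def)
  finally show ?thesis by simp
qed

text \<open>The point masses over the finite nonempty set \<open>S\<close> add up to 1.\<close>

lemma (in prob_space) uniform_rv_AE_mem:
  assumes "uniform_rv M X S" "finite S" "S \<noteq> {}" "X \<in> measurable M (count_space UNIV)"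
  shows "AE \<omega> in M. X \<omega> \<in> S"
  using prob_uniform_rv[OF assms(1,2) order_refl assms(4)] assms(2-4)
  by (subst prob_Collect_eq_1[symmetric]) auto

text \<open>Up to the constant \<open>a powr (- s)\<close>, the terms are a power of
  \<open>n\<close> times \<open>exp (- (c * s - \<gamma>) * n powr \<beta>)\<close>. This decays
  faster than any power of \<open>n\<close>, so comparison with \<open>n powr (-2)\<close>
  suffices.\<close>

lemma summable_growth_ratio:
  fixes a b c \<beta> \<gamma> s :: real
  assumes "a > 0" "\<beta> > 0" "\<gamma> < c * s"
  shows "summable (\<lambda>n. exp (\<gamma> * real n powr \<beta>) * growth a b c \<beta> n powr (- s))"
proof -
  define \<delta> where "\<delta> = c * s - \<gamma>"
  have \<delta>: "\<delta> > 0" using assms by (simp add: \<delta>_def)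
  have "(\<lambda>n. real n powr (b * s) * exp (- \<delta> * real n powr \<beta>)) \<in> O(\<lambda>n. real n powr (-2))"
    using \<delta> \<open>\<beta> > 0\<close> by real_asymp
  hence "summable (\<lambda>n. real n powr (b * s) * exp (- \<delta> * real n powr \<beta>))"
    by (rule summable_comparison_test_bigo[rotated]) (simp add: summable_real_powr_iff)
  hence "summable (\<lambda>n. a powr (- s) * (real n powr (b * s) * exp (- \<delta> * real n powr \<beta>)))"
    by (rule summable_mult)
  moreover have "\<forall>\<^sub>F n in sequentially. exp (\<gamma> * real n powr \<beta>) * growth a b c \<beta> n powr (- s)
      = a powr (- s) * (real n powr (b * s) * exp (- \<delta> * real n powr \<beta>))"
    using eventually_gt_at_top[of 0]
  proof eventually_elim
    case (elim n)
    have "exp (c * real n powr \<beta>) powr (- s) = exp (- (c * s) * real n powr \<beta>)"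
      by (simp add: powr_def)
    thus ?case using elim \<open>a > 0\<close>
      by (simp add: growth_def powr_mult powr_powr \<delta>_def left_diff_distrib exp_diff
            exp_minus field_simps flip: exp_add)
  qed
  ultimately show ?thesis by (simp add: summable_cong)
qed

text \<open>An index \<open>n\<close> beyond the threshold \<open>N\<close> with distance at most
  \<open>d\<close> satisfies \<open>exp ((n / K) powr \<beta>) < d\<close>; solving for
  \<open>n\<close> gives the bound. Indices below \<open>N\<close> are covered once \<open>d\<close>
  is so large that the bound exceeds \<open>N\<close>.\<close>

lemma last_close_less:
  fixes x :: "nat \<Rightarrow> nat" and K \<beta> :: real
  assumes "K > 0" "\<beta> > 0"
    and far: "\<forall>\<^sub>F n in sequentially. exp ((real n / K) powr \<beta>) < real (power_dist k (x n))"
  shows "\<forall>\<^sub>F d in at_top. last_close x k d < ereal (K * ln d powr (1 / \<beta>))"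
proof -
  obtain N where N: "\<And>n. n \<ge> N \<Longrightarrow> exp ((real n / K) powr \<beta>) < real (power_dist k (x n))"
    using far by (auto simp: eventually_sequentially)
  have "filterlim (\<lambda>d. K * ln d powr (1 / \<beta>)) at_top at_top"
    using assms(1,2) by real_asymp
  hence "\<forall>\<^sub>F d in at_top. real N < K * ln d powr (1 / \<beta>)"
    by (simp add: filterlim_at_top_dense)
  thus ?thesis
    \<comment> \<open>The last condition puts the index 1 into the set of close indices, which
      avoids the value \<open>\<infinity>\<close> assigned to the empty set.\<close>
    using eventually_gt_at_top[of 1] eventually_ge_at_top[of "real (power_dist k (x 1))"]
  proof eventually_elim
    case (elim d)
    define S where "S = {n. 1 \<le> n \<and> real (power_dist k (x n)) \<le> d}"
    have less: "real n < K * ln d powr (1 / \<beta>)" if "n \<in> S" for n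
    proof (cases "n < N")
      case True
      thus ?thesis using elim(1) by simp
    next
      case False
      hence "exp ((real n / K) powr \<beta>) < d" using N[of n] that by (simp add: S_def)
      hence "(real n / K) powr \<beta> < ln d" using elim(2) by (subst exp_less_cancel_iff[symmetric]) simp
      hence "((real n / K) powr \<beta>) powr (1 / \<beta>) < ln d powr (1 / \<beta>)"
        using \<open>\<beta> > 0\<close> by (intro powr_less_mono2) auto
      hence "real n / K < ln d powr (1 / \<beta>)" using assms(1,2) by (simp add: powr_powr)
      thus ?thesis using \<open>K > 0\<close> by (simp add: field_simps)
    qed
    have "finite S"
      by (rule finite_subset[OF _ finite_nat_between[of 0 "K * ln d powr (1 / \<beta>)"]])
        (use less in force)
    moreover have "S \<noteq> {}" using elim(3) by (auto simp: S_def)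
    ultimately have "last_close x k d = ereal (real (Max S))"
      unfolding last_close_def S_def[symmetric] Let_def by simp
    thus ?case using less[OF Max_in[OF \<open>finite S\<close> \<open>S \<noteq> {}\<close>]] by simp
  qed
qed

theorem theorem7p6:
  fixes a b c \<beta> :: real
    and k :: nat
    and e :: "nat \<Rightarrow> real"
    and P :: "'w measure"
    and f :: "nat \<Rightarrow> 'w \<Rightarrow> nat"
  assumes "a > 0" and "b > 0" and "c > 0" and "\<beta> > 0"
    and "k \<ge> 2"
    and "\<And>n. n \<ge> 1 \<Longrightarrow> e n > 0"
    and "e \<longlonglongrightarrow> 0"
    and "seq_gg e (\<lambda>n. ln (growth a b c \<beta> n) / sqrt (growth a b c \<beta> n))"
    and "seq_gg e (\<lambda>n. growth a b c \<beta> n powr (- 1 / real k))"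
    and "prob_space P"
    and "\<And>n. n \<ge> 1 \<Longrightarrow> f n \<in> measurable P (count_space UNIV)"
    and "\<And>n. n \<ge> 1 \<Longrightarrow> window (growth a b c \<beta>) e n \<noteq> {} \<Longrightarrow>
           uniform_rv P (f n) (window (growth a b c \<beta>) e n)"
  shows "\<forall>\<epsilon>>0. AE \<omega> in P. \<forall>\<^sub>F d in at_top.
           last_close (\<lambda>n. f n \<omega>) k d
             < ereal ((2 powr (1 / \<beta>) + \<epsilon>) * (real k / (c * (real k - 1))) powr (1 / \<beta>)
                        * ln d powr (1 / \<beta>))"
proof (intro allI impI)
  fix \<epsilon> :: real assume "\<epsilon> > 0"
  interpret prob_space P by fact
  define A where "A = growth a b c \<beta>"
  define K where "K = (2 powr (1 / \<beta>) + \<epsilon>) * (real k / (c * (real k - 1))) powr (1 / \<beta>)"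
  \<comment> \<open>\<open>\<gamma>\<close> is the exponential rate of \<open>D\<close>, and
    \<open>q n\<close> is, up to a constant, the bound on the probability that \<open>f n\<close> is
    within \<open>D n\<close> of a power.\<close>
  define \<gamma> where "\<gamma> = 1 / K powr \<beta>"
  define s where "s = 1 - 1 / real k"
  define D where "D n = exp ((real n / K) powr \<beta>)" for n :: nat
  define q where "q n = D n * A n powr (- s)" for n
  have ck: "real k / (c * (real k - 1)) > 0" using \<open>c > 0\<close> \<open>k \<ge> 2\<close> by simp
  have "2 powr (1 / \<beta>) + \<epsilon> > 0" using \<open>\<epsilon> > 0\<close> by (simp add: add_pos_pos)
  hence K: "K > 0" unfolding K_def using ck by (metis mult_pos_pos powr_gt_zero less_irrefl)
  have D: "D n = exp (\<gamma> * real n powr \<beta>)" for n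
    using K by (simp add: D_def \<gamma>_def powr_divide)
  have "K powr \<beta> = (2 powr (1 / \<beta>) + \<epsilon>) powr \<beta> * (real k / (c * (real k - 1)))"
    using \<open>\<beta> > 0\<close> \<open>c > 0\<close> \<open>k \<ge> 2\<close> \<open>\<epsilon> > 0\<close> unfolding K_def
    by (subst powr_mult) (auto simp: powr_powr)
  \<comment> \<open>The \<open>\<beta>\<close>-th power of the leading factor of \<open>K\<close>
    exceeds 1. This puts \<open>\<gamma>\<close> strictly below \<open>c * s\<close>, as summability
    of \<open>q\<close> requires.\<close>
  moreover have "(2 powr (1 / \<beta>)) powr \<beta> < (2 powr (1 / \<beta>) + \<epsilon>) powr \<beta>"
    using \<open>\<beta> > 0\<close> \<open>\<epsilon> > 0\<close> by (intro powr_less_mono2) auto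
  hence "1 < (2 powr (1 / \<beta>) + \<epsilon>) powr \<beta>" using \<open>\<beta> > 0\<close> by (simp add: powr_powr)
  ultimately have "real k / (c * (real k - 1)) < K powr \<beta>"
    using mult_strict_right_mono[OF _ ck, of 1] by (simp only: mult_1)
  hence "\<gamma> < 1 / (real k / (c * (real k - 1)))"
    unfolding \<gamma>_def
    using ck K by (intro divide_strict_left_mono mult_pos_pos) auto
  also have "\<dots> = c * s" using \<open>k \<ge> 2\<close> by (simp add: s_def field_simps)
  finally have "summable q" unfolding q_def D A_def
    using \<open>a > 0\<close> \<open>\<beta> > 0\<close> by (intro summable_growth_ratio)
  hence q0: "q \<longlonglongrightarrow> 0" by (rule summable_LIMSEQ_zero)

  obtain C where C: "C > 0" "\<forall>\<^sub>F n in sequentially. C * A n powr (- 1 / real k) \<le> e n"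
    using assms(9) by (auto simp: seq_gg_def A_def)
  \<comment> \<open>Together with the lower bound on \<open>e n\<close>, this gives
    \<open>D n \<le> A n * e n\<close>, and so also \<open>1 \<le> A n * e n\<close>.\<close>
  have "\<forall>\<^sub>F n in sequentially. q n < C"
    using q0 \<open>C > 0\<close> by (rule order_tendstoD)
  moreover have "\<forall>\<^sub>F n in sequentially. e n < 1/4"
    using assms(7) by (rule order_tendstoD) simp
  moreover note C(2) eventually_ge_at_top[of 1]
  ultimately have ev: "\<forall>\<^sub>F n in sequentially.
      n \<ge> 1 \<and> prob {\<omega>\<in>space P. f n \<omega> \<in> window A e n \<and> real (power_dist k (f n \<omega>)) \<le> D n}
             \<le> 3 * (8 + 1 / C) * q n \<and> (AE \<omega> in P. f n \<omega> \<in> window A e n)"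
  proof eventually_elim
    case (elim n)
    have A: "A n > 0" using \<open>a > 0\<close> \<open>n \<ge> 1\<close> by (simp add: A_def growth_def)
    have D1: "1 \<le> D n" by (simp add: D_def)
    have "D n = q n * A n powr s" using A by (simp add: q_def powr_minus)
    also have "\<dots> \<le> C * A n powr s" using elim(1) by (intro mult_right_mono) auto
    also have "\<dots> = A n * (C * A n powr (- 1 / real k))"
      using A by (simp add: s_def powr_diff powr_minus) (simp add: field_simps)
    also have "\<dots> \<le> A n * e n" using elim(3) A by (intro mult_left_mono) auto
    finally have DA: "D n \<le> A n * e n" .
    have W: "window A e n
        = {x::nat. 1 \<le> x \<and> A n * (1 - e n) \<le> real x \<and> real x \<le> A n * (1 + e n)}"
      by (simp add: window_def)
    have npp: "finite (window A e n)" "window A e n \<noteq> {}"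
        "real (card {x\<in>window A e n. real (power_dist k x) \<le> D n}) / real (card (window A e n))
           \<le> 3 * (8 + 1 / C) * (D n * A n powr (1 / real k - 1))"
      unfolding W
      using near_power_proportion[of "A n" "e n" "D n" C k] A assms(6)[of n] elim D1 DA C(1)
        \<open>k \<ge> 2\<close> by auto
    \<comment> \<open>The size estimate has shown that the window is nonempty, so the distribution
      of \<open>f n\<close> is known.\<close>
    have u: "uniform_rv P (f n) (window A e n)"
      using assms(12)[of n] elim(4) npp(2) by (simp add: A_def)
    have f: "f n \<in> measurable P (count_space UNIV)" using assms(11) elim(4) by blast
    have "prob {\<omega>\<in>space P. f n \<omega> \<in> {x\<in>window A e n. real (power_dist k x) \<le> D n}}
        \<le> 3 * (8 + 1 / C) * q n"
      using npp(1,3) by (subst prob_uniform_rv[OF u _ _ f]) (auto simp: q_def s_def)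
    thus ?case using elim(4) uniform_rv_AE_mem[OF u npp(1,2) f] by simp
  qed

  then obtain N where N: "\<And>n. n \<ge> N \<Longrightarrow> n \<ge> 1 \<and>
        prob {\<omega>\<in>space P. f n \<omega> \<in> window A e n \<and> real (power_dist k (f n \<omega>)) \<le> D n}
             \<le> 3 * (8 + 1 / C) * q n \<and> (AE \<omega> in P. f n \<omega> \<in> window A e n)"
    by (auto simp: eventually_sequentially)
  \<comment> \<open>The conjunct \<open>n \<ge> N\<close> makes the early events empty, so that
    measurability and the probability bound hold for every index, including 0.\<close>
  define E where "E n = {\<omega>\<in>space P. n \<ge> N \<and> f n \<omega> \<in> window A e n \<and>
                              real (power_dist k (f n \<omega>)) \<le> D n}" for n
  have E: "E n \<in> sets P" for n
  proof (cases "n \<ge> N")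
    case True
    hence [measurable]: "f n \<in> measurable P (count_space UNIV)" using N assms(11) by blast
    show ?thesis unfolding E_def by measurable
  qed (simp add: E_def)
  have "summable (\<lambda>n. prob (E n))"
  proof (rule summable_comparison_test)
    show "\<exists>N. \<forall>n\<ge>N. norm (prob (E n)) \<le> 3 * (8 + 1 / C) * q n"
      using N by (intro exI[of _ N]) (auto simp: E_def)
    show "summable (\<lambda>n. 3 * (8 + 1 / C) * q n)"
      using \<open>summable q\<close> by (rule summable_mult)
  qed
  hence "AE \<omega> in P. \<forall>\<^sub>F n in sequentially. \<omega> \<in> space P - E n"
    using E by (intro borel_cantelli_AE1) (auto simp: emeasure_eq_measure)
  \<comment> \<open>The events \<open>E n\<close> only concern values in the window. Almost sure
    membership for all \<open>n \<ge> N\<close> at once turns the failure of \<open>E n\<close> into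
    a distance larger than \<open>D n\<close>.\<close>
  moreover have "AE \<omega> in P. \<forall>n. n \<ge> N \<longrightarrow> f n \<omega> \<in> window A e n"
    using N by (intro AE_all_countable[THEN iffD2] allI) (auto intro: AE_I2)
  ultimately have "AE \<omega> in P. \<forall>\<^sub>F n in sequentially. D n < real (power_dist k (f n \<omega>))"
  proof eventually_elim
    case (elim \<omega>)
    from elim(1) eventually_ge_at_top[of N] show ?case
      by eventually_elim (use elim(2) in \<open>auto simp: E_def not_le\<close>)
  qed
  thus "AE \<omega> in P. \<forall>\<^sub>F d in at_top. last_close (\<lambda>n. f n \<omega>) k d
             < ereal ((2 powr (1 / \<beta>) + \<epsilon>) * (real k / (c * (real k - 1))) powr (1 / \<beta>)
                        * ln d powr (1 / \<beta>))"
    unfolding D_def K_def[symmetric]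
    by eventually_elim (rule last_close_less[OF K \<open>\<beta> > 0\<close>])
qed

end
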